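(* Let $\Sigma$ be an alphabet and $\Gamma\subseteq\Sigma$. Suppose $\mathcal V$ is a variety of commutative languages. If $L\in\mathcal V(\Sigma^* )$, then $\pi_\Gamma(L)\in\mathcal V(\Gamma^* )$. In particular, the variety of (all regular) commutative languages is closed under projection.
   Context: Alphabets are finite. For $\Gamma\subseteq\Sigma$, the projection $\pi_\Gamma:\Sigma^*\to\Gamma^*$ is the monoid homomorphism with $\pi_\Gamma(x)=x$ for $x\in\Gamma$ and $\pi_\Gamma(x)=\varepsilon$ for $x\in\Sigma\setminus\Gamma$. A variety (of formal languages) $\mathcal V$ associates to each alphabet $\Sigma$ a class $\mathcal V(\Sigma^* )$ of recognizable (regular) languages over $\Sigma$ such that: (1) $\mathcal V(\Sigma^* )$ is a boolean algebra; (2) if $\varphi:\Sigma^*\to\Gamma^*$ is a homomorphism, then $L\in\mathcal V(\Gamma^* )$ implies $\varphi^{-1}(L)\in\mathcal V(\Sigma^* )$; (3) if $L\in\mathcal V(\Sigma^* )$ and $x\in\Sigma$, then $\{u\in\Sigma^*\mid xu\in L\}$ and $\{u\in\Sigma^*\mid ux\in L\}$ are in $\mathcal V(\Sigma^* )$. A language $L\subseteq\Sigma^*$ is commutative if it is closed under permuting the letters of words, i.e. $uabv\in L\Leftrightarrow ubav\in L$ for all $u,v\in\Sigma^*$, $a,b\in\Sigma$. A variety of commutative languages is a variety $\mathcal V$ such that for every alphabet $\Sigma$ every language in $\mathcal V(\Sigma^* )$ is commutative. *)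

theory Defs
  imports "HOL-Analysis.Sigma_Algebra"
begin

text \<open>Alphabets are finite subsets of a common, arbitrary type of letters; the words over
  \<open>\<Sigma>\<close> are the members of \<open>lists \<Sigma>\<close>. A class of languages takes an alphabet to a set of
  languages; its values at infinite sets are irrelevant throughout.\<close>

type_synonym 'a lang_class = "'a set \<Rightarrow> 'a list set set"

text \<open>Recognizability by a complete deterministic finite automaton. Taking the states to be
  natural numbers loses no generality, because the set of states is finite.\<close>

definition regular_lang :: "'a set \<Rightarrow> 'a list set \<Rightarrow> bool" where
  "regular_lang \<Sigma> L \<longleftrightarrow>
     (\<exists>(Q :: nat set) (\<delta> :: nat \<Rightarrow> 'a \<Rightarrow> nat) q0 F.
        finite Q \<and> q0 \<in> Q \<and> F \<subseteq> Q \<and> (\<forall>q\<in>Q. \<forall>x\<in>\<Sigma>. \<delta> q x \<in> Q) \<and>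
        L = {w \<in> lists \<Sigma>. foldl \<delta> q0 w \<in> F})"

definition word_hom :: "'a set \<Rightarrow> 'b set \<Rightarrow> ('a list \<Rightarrow> 'b list) \<Rightarrow> bool" where
  "word_hom \<Sigma> \<Gamma> \<phi> \<longleftrightarrow>
     (\<forall>u\<in>lists \<Sigma>. \<phi> u \<in> lists \<Gamma>) \<and> \<phi> [] = [] \<and>
     (\<forall>u\<in>lists \<Sigma>. \<forall>v\<in>lists \<Sigma>. \<phi> (u @ v) = \<phi> u @ \<phi> v)"

definition proj :: "'a set \<Rightarrow> 'a list \<Rightarrow> 'a list" where
  "proj \<Gamma> w = filter (\<lambda>x. x \<in> \<Gamma>) w"

text \<open>The library predicate \<open>algebra \<Omega> M\<close> says that \<open>M\<close> is a boolean algebra of subsets of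
  \<open>\<Omega>\<close> (a field of sets).\<close>

locale variety =
  fixes V :: "'a lang_class"
  assumes regular: "\<lbrakk>finite \<Sigma>; L \<in> V \<Sigma>\<rbrakk> \<Longrightarrow> regular_lang \<Sigma> L"
    and boolean_algebra: "finite \<Sigma> \<Longrightarrow> algebra (lists \<Sigma>) (V \<Sigma>)"
    and inverse_hom: "\<lbrakk>finite \<Sigma>; finite \<Gamma>; word_hom \<Sigma> \<Gamma> \<phi>; L \<in> V \<Gamma>\<rbrakk>
          \<Longrightarrow> {w \<in> lists \<Sigma>. \<phi> w \<in> L} \<in> V \<Sigma>"
    and left_quotient: "\<lbrakk>finite \<Sigma>; L \<in> V \<Sigma>; x \<in> \<Sigma>\<rbrakk> \<Longrightarrow> {u \<in> lists \<Sigma>. x # u \<in> L} \<in> V \<Sigma>"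
    and right_quotient: "\<lbrakk>finite \<Sigma>; L \<in> V \<Sigma>; x \<in> \<Sigma>\<rbrakk> \<Longrightarrow> {u \<in> lists \<Sigma>. u @ [x] \<in> L} \<in> V \<Sigma>"

definition commutative_lang :: "'a set \<Rightarrow> 'a list set \<Rightarrow> bool" where
  "commutative_lang \<Sigma> L \<longleftrightarrow> L \<subseteq> lists \<Sigma> \<and>
     (\<forall>u\<in>lists \<Sigma>. \<forall>v\<in>lists \<Sigma>. \<forall>a\<in>\<Sigma>. \<forall>b\<in>\<Sigma>.
        u @ [a, b] @ v \<in> L \<longleftrightarrow> u @ [b, a] @ v \<in> L)"

locale commutative_variety = variety V for V :: "'a lang_class" +
  assumes commutative: "\<lbrakk>finite \<Sigma>; L \<in> V \<Sigma>\<rbrakk> \<Longrightarrow> commutative_lang \<Sigma> L"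

definition commutative_regular_langs :: "'a lang_class" where
  "commutative_regular_langs \<Sigma> = {L. regular_lang \<Sigma> L \<and> commutative_lang \<Sigma> L}"

end

theory Submission imports Defs "HOL-Library.Multiset" begin

text \<open>In a commutative language the letters outside \<open>\<Gamma>\<close> may be moved to the front of a word, so
  \<open>\<pi>\<^sub>\<Gamma>(L)\<close> is the union over \<open>v \<in> (\<Sigma> \<setminus> \<Gamma>)\<^sup>*\<close> of the left quotients \<open>v\<inverse>L\<close>, restricted to \<open>\<Gamma>\<^sup>*\<close>.
  The quotient \<open>v\<inverse>L\<close> depends only on the state that \<open>v\<close> reaches in an automaton for \<open>L\<close>, so the
  union is finite, and the restriction is an inverse image under the inclusion
  \<open>\<Gamma>\<^sup>* \<rightarrow> \<Sigma>\<^sup>*\<close>.\<close>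

section \<open>Automata and closure properties of regular languages\<close>

lemma foldl_closed:
  assumes "\<forall>q\<in>Q. \<forall>x\<in>\<Sigma>. \<delta> q x \<in> Q" "w \<in> lists \<Sigma>" "q \<in> Q"
  shows "foldl \<delta> q w \<in> Q"
  using assms(2,3) by (induction w arbitrary: q) (use assms(1) in auto)

text \<open>Allowing states of any type lets products and other constructions be used directly. A
  finite state set embeds into the naturals, and the automaton is transported along that
  injection.\<close>

lemma regular_langI:
  fixes Q :: "'q set"
  assumes "finite Q" "s \<in> Q" "F \<subseteq> Q" and closed: "\<forall>q\<in>Q. \<forall>x\<in>\<Sigma>. \<delta> q x \<in> Q"
    and L: "L = {w \<in> lists \<Sigma>. foldl \<delta> s w \<in> F}"
  shows "regular_lang \<Sigma> L"
proof -
  obtain f :: "'q \<Rightarrow> nat" where f: "inj_on f Q"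
    using finite_imp_inj_to_nat_seg[OF \<open>finite Q\<close>] by blast
  \<comment> \<open>A number is decoded to a state, one transition is made, and the result is
    encoded again. Values at numbers that encode no state are arbitrary and never reached from
    \<open>f s\<close>.\<close>
  define \<delta>' where "\<delta>' n x = f (\<delta> (inv_into Q f n) x)" for n x
  have run: "foldl \<delta>' (f q) w = f (foldl \<delta> q w)" if "w \<in> lists \<Sigma>" "q \<in> Q" for w q
    using that by (induction w arbitrary: q) (simp_all add: \<delta>'_def f closed)
  \<comment> \<open>Since \<open>f\<close> is injective only on \<open>Q\<close>, comparing images
    requires that the run stays in \<open>Q\<close>.\<close>
  have "f (foldl \<delta> s w) \<in> f ` F \<longleftrightarrow> foldl \<delta> s w \<in> F" if "w \<in> lists \<Sigma>" for w
    by (rule inj_on_image_mem_iff[OF f foldl_closed[OF closed that \<open>s \<in> Q\<close>] \<open>F \<subseteq> Q\<close>])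
  then have "L = {w \<in> lists \<Sigma>. foldl \<delta>' (f s) w \<in> f ` F}"
    unfolding L by (simp add: run[OF _ \<open>s \<in> Q\<close>] cong: conj_cong)
  moreover have "\<forall>n\<in>f ` Q. \<forall>x\<in>\<Sigma>. \<delta>' n x \<in> f ` Q"
    using closed f by (auto simp: \<delta>'_def)
  moreover have "finite (f ` Q)" "f s \<in> f ` Q" "f ` F \<subseteq> f ` Q"
    using assms(1-3) by (simp_all add: image_mono)
  ultimately show ?thesis
    unfolding regular_lang_def by blast
qed

lemma regular_langE:
  assumes "regular_lang \<Sigma> L"
  obtains Q :: "nat set" and \<delta> q0 F where "finite Q" "q0 \<in> Q" "F \<subseteq> Q"
    "\<forall>q\<in>Q. \<forall>x\<in>\<Sigma>. \<delta> q x \<in> Q" "L = {w \<in> lists \<Sigma>. foldl \<delta> q0 w \<in> F}"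
  using assms unfolding regular_lang_def by blast

lemma regular_lang_empty: "regular_lang \<Sigma> {}"
  by (rule regular_langI[where Q = "{()}" and F = "{}"]) auto

lemma regular_lang_complement:
  assumes "regular_lang \<Sigma> L"
  shows "regular_lang \<Sigma> (lists \<Sigma> - L)"
  using assms
proof (cases rule: regular_langE)
  case (1 Q \<delta> q0 F)
  show ?thesis
    by (rule regular_langI[where Q = Q and s = q0 and \<delta> = \<delta> and F = "Q - F"])
      (use 1 foldl_closed[OF 1(4) _ 1(2)] in auto)
qed

lemma regular_lang_union:
  assumes "regular_lang \<Sigma> L" "regular_lang \<Sigma> M"
  shows "regular_lang \<Sigma> (L \<union> M)"
  using assms(1)
proof (cases rule: regular_langE)
  case L: (1 Q \<delta> q0 F)
  from assms(2) show ?thesis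
  proof (cases rule: regular_langE)
    case M: (1 R \<rho> r0 G)
    define step where "step = (\<lambda>(q, r) x. (\<delta> q x, \<rho> r x))"
    have run: "foldl step (q, r) w = (foldl \<delta> q w, foldl \<rho> r w)" for q r w
      by (induction w arbitrary: q r) (auto simp: step_def)
    show ?thesis
    proof (rule regular_langI)
      \<comment> \<open>In the product automaton one accepting component suffices; the other need
        only lie in its own state set, which \<open>foldl_closed\<close> guarantees.\<close>
      show "finite (Q \<times> R)" "(q0, r0) \<in> Q \<times> R" "F \<times> R \<union> Q \<times> G \<subseteq> Q \<times> R"
        using L M by auto
      show "\<forall>q\<in>Q \<times> R. \<forall>x\<in>\<Sigma>. step q x \<in> Q \<times> R"
        using L(4) M(4) by (auto simp: step_def)
      show "L \<union> M = {w \<in> lists \<Sigma>. foldl step (q0, r0) w \<in> F \<times> R \<union> Q \<times> G}"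
        unfolding run L(5) M(5)
        using foldl_closed[OF L(4) _ L(2)] foldl_closed[OF M(4) _ M(2)] by auto
    qed
  qed
qed

lemma word_hom_Cons:
  assumes "word_hom \<Sigma> \<Gamma> \<phi>" "x \<in> \<Sigma>" "w \<in> lists \<Sigma>"
  shows "\<phi> (x # w) = \<phi> [x] @ \<phi> w"
proof -
  have "\<phi> ([x] @ w) = \<phi> [x] @ \<phi> w"
    using assms unfolding word_hom_def by (metis lists.Cons lists.Nil)
  then show ?thesis by simp
qed

lemma word_hom_lists: "\<lbrakk>word_hom \<Sigma> \<Gamma> \<phi>; w \<in> lists \<Sigma>\<rbrakk> \<Longrightarrow> \<phi> w \<in> lists \<Gamma>"
  unfolding word_hom_def by blast

lemma word_hom_Nil: "word_hom \<Sigma> \<Gamma> \<phi> \<Longrightarrow> \<phi> [] = []"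
  unfolding word_hom_def by blast

lemma word_hom_append:
  "\<lbrakk>word_hom \<Sigma> \<Gamma> \<phi>; u \<in> lists \<Sigma>; v \<in> lists \<Sigma>\<rbrakk> \<Longrightarrow> \<phi> (u @ v) = \<phi> u @ \<phi> v"
  unfolding word_hom_def by blast

lemma regular_lang_inverse_hom:
  assumes "regular_lang \<Gamma> L" and \<phi>: "word_hom \<Sigma> \<Gamma> \<phi>"
  shows "regular_lang \<Sigma> {w \<in> lists \<Sigma>. \<phi> w \<in> L}"
  using assms(1)
proof (cases rule: regular_langE)
  case (1 Q \<delta> q0 F)
  \<comment> \<open>Reading the letter \<open>x\<close> simulates the original automaton on the
    whole word \<open>\<phi> [x]\<close>.\<close>
  define step where "step q x = foldl \<delta> q (\<phi> [x])" for q x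
  have run: "foldl step q w = foldl \<delta> q (\<phi> w)" if "w \<in> lists \<Sigma>" for w q
    using that
  proof (induction w arbitrary: q)
    case (Cons x w)
    then show ?case
      using word_hom_Cons[OF \<phi>, of x w] by (simp add: step_def)
  qed (simp add: word_hom_Nil[OF \<phi>])
  show ?thesis
  proof (rule regular_langI[where \<delta> = step])
    show "\<forall>q\<in>Q. \<forall>x\<in>\<Sigma>. step q x \<in> Q"
      unfolding step_def using foldl_closed[OF 1(4)] word_hom_lists[OF \<phi>]
      by (meson lists.Cons lists.Nil)
    show "{w \<in> lists \<Sigma>. \<phi> w \<in> L} = {w \<in> lists \<Sigma>. foldl step q0 w \<in> F}"
      unfolding 1(5) by (simp add: run word_hom_lists[OF \<phi>] cong: conj_cong)
  qed (rule 1(1-3))+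
qed

lemma regular_lang_left_quotient:
  assumes "regular_lang \<Sigma> L" "x \<in> \<Sigma>"
  shows "regular_lang \<Sigma> {u \<in> lists \<Sigma>. x # u \<in> L}"
  using assms(1)
proof (cases rule: regular_langE)
  case (1 Q \<delta> q0 F)
  show ?thesis
    by (rule regular_langI[where Q = Q and s = "\<delta> q0 x" and \<delta> = \<delta> and F = F])
      (use 1(1-4) assms(2) in \<open>auto simp: 1(5)\<close>)
qed

lemma regular_lang_right_quotient:
  assumes "regular_lang \<Sigma> L" "x \<in> \<Sigma>"
  shows "regular_lang \<Sigma> {u \<in> lists \<Sigma>. u @ [x] \<in> L}"
  using assms(1)
proof (cases rule: regular_langE)
  case (1 Q \<delta> q0 F)
  show ?thesis
    \<comment> \<open>The missing final letter is absorbed into acceptance, just as a missing first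
      letter is absorbed into the start state.\<close>
    by (rule regular_langI[where Q = Q and s = q0 and \<delta> = \<delta> and F = "{q \<in> Q. \<delta> q x \<in> F}"])
      (use 1(1-4) assms(2) foldl_closed[OF 1(4) _ 1(2)] in \<open>auto simp: 1(5)\<close>)
qed

section \<open>Commutativity as invariance under rearrangement\<close>

lemma commutative_lang_subset: "commutative_lang \<Sigma> L \<Longrightarrow> L \<subseteq> lists \<Sigma>"
  unfolding commutative_lang_def by blast

text \<open>Adjacent swaps carry \<open>a\<close> past the letters of \<open>x\<close> one at a
  time; each letter already passed joins the prefix \<open>u\<close>, which is therefore generalized
  in the induction.\<close>

lemma commutative_lang_move_letter:
  assumes L: "commutative_lang \<Sigma> L"
    and "u \<in> lists \<Sigma>" "x \<in> lists \<Sigma>" "y \<in> lists \<Sigma>" "a \<in> \<Sigma>"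
  shows "u @ a # x @ y \<in> L \<longleftrightarrow> u @ x @ a # y \<in> L"
  using \<open>x \<in> lists \<Sigma>\<close> \<open>u \<in> lists \<Sigma>\<close>
proof (induction x arbitrary: u)
  case (Cons b x)
  have "u @ [a, b] @ (x @ y) \<in> L \<longleftrightarrow> u @ [b, a] @ (x @ y) \<in> L"
    using L Cons.hyps Cons.prems assms(4,5) unfolding commutative_lang_def by simp
  also have "\<dots> \<longleftrightarrow> (u @ [b]) @ x @ a # y \<in> L"
    using Cons.IH[of "u @ [b]"] Cons by simp
  finally show ?case by simp
qed simp

text \<open>The first letter of \<open>v\<close> occurs in \<open>w\<close> and can be moved to the
  front there. It then joins the common prefix, leaving shorter words with equal multisets.\<close>

lemma commutative_lang_permute:
  assumes L: "commutative_lang \<Sigma> L" and "mset v = mset w" "v \<in> lists \<Sigma>" "u \<in> lists \<Sigma>"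
  shows "u @ v \<in> L \<longleftrightarrow> u @ w \<in> L"
  using assms(2-)
proof (induction v arbitrary: u w)
  case (Cons a v)
  then have "a \<in> set w"
    by (metis list.set_intros(1) mset_eq_setD)
  then obtain x y where w: "w = x @ a # y"
    by (meson split_list)
  have "set w \<subseteq> \<Sigma>"
    using Cons.prems by (metis in_listsD mset_eq_setD subsetI)
  then have xy: "x \<in> lists \<Sigma>" "y \<in> lists \<Sigma>" "a \<in> \<Sigma>"
    by (auto simp: w)
  have "(u @ [a]) @ v \<in> L \<longleftrightarrow> (u @ [a]) @ (x @ y) \<in> L"
    using Cons xy by (intro Cons.IH) (auto simp: w)
  then show ?case
    using commutative_lang_move_letter[OF L _ xy] Cons.prems by (simp add: w)
qed simp

lemma mset_in_lists:
  assumes "mset v = mset w"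
  shows "v \<in> lists \<Sigma> \<longleftrightarrow> w \<in> lists \<Sigma>"
  using mset_eq_setD[OF assms] by (simp add: in_lists_conv_set)

text \<open>This is the working form of commutativity. Words need not be assumed to be over
  \<open>\<Sigma>\<close>: words with equal multisets are both over it or both outside it, and in
  the latter case neither is in \<open>L\<close>.\<close>

lemma commutative_lang_mset:
  assumes "commutative_lang \<Sigma> L" "mset v = mset w"
  shows "v \<in> L \<longleftrightarrow> w \<in> L"
proof -
  have "L \<subseteq> lists \<Sigma>"
    by (rule commutative_lang_subset[OF assms(1)])
  then show ?thesis
    using commutative_lang_permute[OF assms _ lists.Nil] mset_in_lists[OF assms(2), of \<Sigma>]
    unfolding append_Nil by blast
qed

lemma commutative_langI:
  assumes "L \<subseteq> lists \<Sigma>"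
    and "\<And>v w. \<lbrakk>mset v = mset w; v \<in> lists \<Sigma>; w \<in> lists \<Sigma>; v \<in> L\<rbrakk> \<Longrightarrow> w \<in> L"
  shows "commutative_lang \<Sigma> L"
  unfolding commutative_lang_def
proof (intro conjI ballI)
  fix u v a b
  assume "u \<in> lists \<Sigma>" "v \<in> lists \<Sigma>" "a \<in> \<Sigma>" "b \<in> \<Sigma>"
  then show "u @ [a, b] @ v \<in> L \<longleftrightarrow> u @ [b, a] @ v \<in> L"
    using assms(2)[of "u @ [a, b] @ v" "u @ [b, a] @ v"]
      assms(2)[of "u @ [b, a] @ v" "u @ [a, b] @ v"] by auto
qed (rule assms(1))

lemma commutative_lang_complement:
  assumes "commutative_lang \<Sigma> L"
  shows "commutative_lang \<Sigma> (lists \<Sigma> - L)"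
proof (rule commutative_langI)
  fix v w
  assume "mset v = mset w" "w \<in> lists \<Sigma>" "v \<in> lists \<Sigma> - L"
  then show "w \<in> lists \<Sigma> - L"
    using commutative_lang_mset[OF assms, of v w] by blast
qed blast

lemma commutative_lang_union:
  assumes "commutative_lang \<Sigma> L" "commutative_lang \<Sigma> M"
  shows "commutative_lang \<Sigma> (L \<union> M)"
proof (rule commutative_langI)
  fix v w
  assume "mset v = mset w" "v \<in> L \<union> M"
  then show "w \<in> L \<union> M"
    using commutative_lang_mset[OF assms(1), of v w] commutative_lang_mset[OF assms(2), of v w]
    by blast
qed (use assms[THEN commutative_lang_subset] in blast)

text \<open>Swapping two letters exchanges two adjacent blocks of the image, whose lengths are
  arbitrary. This preserves the multiset, so the multiset criterion applies.\<close>

lemma commutative_lang_inverse_hom: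
  assumes L: "commutative_lang \<Gamma> L" and \<phi>: "word_hom \<Sigma> \<Gamma> \<phi>"
  shows "commutative_lang \<Sigma> {w \<in> lists \<Sigma>. \<phi> w \<in> L}"
  unfolding commutative_lang_def
proof (intro conjI ballI)
  fix u v a b
  assume "u \<in> lists \<Sigma>" "v \<in> lists \<Sigma>" "a \<in> \<Sigma>" "b \<in> \<Sigma>"
  then have "mset (\<phi> (u @ [a, b] @ v)) = mset (\<phi> (u @ [b, a] @ v))"
    by (simp add: word_hom_append[OF \<phi>] word_hom_Cons[OF \<phi>, of a "b # v"]
        word_hom_Cons[OF \<phi>, of b "a # v"] word_hom_Cons[OF \<phi>, of a v] word_hom_Cons[OF \<phi>, of b v])
  from commutative_lang_mset[OF L this] \<open>u \<in> _\<close> \<open>v \<in> _\<close> \<open>a \<in> _\<close> \<open>b \<in> _\<close>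
  show "u @ [a, b] @ v \<in> {w \<in> lists \<Sigma>. \<phi> w \<in> L} \<longleftrightarrow> u @ [b, a] @ v \<in> {w \<in> lists \<Sigma>. \<phi> w \<in> L}"
    by auto
qed auto

section \<open>The variety of commutative regular languages\<close>

lemma commutative_variety_regular:
  "commutative_variety (commutative_regular_langs :: 'a lang_class)"
proof (intro commutative_variety.intro variety.intro commutative_variety_axioms.intro)
  fix \<Sigma> \<Gamma> :: "'a set" and L and \<phi> and x
  show "algebra (lists \<Sigma>) (commutative_regular_langs \<Sigma>)"
    unfolding algebra_iff_Un
  proof (intro conjI ballI)
    show "commutative_regular_langs \<Sigma> \<subseteq> Pow (lists \<Sigma>)"
      by (auto simp: commutative_regular_langs_def commutative_lang_def)
    show "{} \<in> commutative_regular_langs \<Sigma>"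
      using regular_lang_empty by (simp add: commutative_regular_langs_def commutative_lang_def)
  qed (simp_all add: commutative_regular_langs_def regular_lang_complement regular_lang_union
      commutative_lang_complement commutative_lang_union)
  show "regular_lang \<Sigma> L" "commutative_lang \<Sigma> L" if "L \<in> commutative_regular_langs \<Sigma>"
    using that unfolding commutative_regular_langs_def by auto
  show "{w \<in> lists \<Sigma>. \<phi> w \<in> L} \<in> commutative_regular_langs \<Sigma>"
    if "word_hom \<Sigma> \<Gamma> \<phi>" "L \<in> commutative_regular_langs \<Gamma>"
    using that regular_lang_inverse_hom commutative_lang_inverse_hom
    unfolding commutative_regular_langs_def by blast
  assume "L \<in> commutative_regular_langs \<Sigma>" "x \<in> \<Sigma>"
  then have reg: "regular_lang \<Sigma> L" and com: "commutative_lang \<Sigma> L"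
    unfolding commutative_regular_langs_def by auto
  have "commutative_lang \<Sigma> {u \<in> lists \<Sigma>. x # u \<in> L}"
  proof (rule commutative_langI)
    fix v w
    assume "mset v = mset w" "w \<in> lists \<Sigma>" "v \<in> {u \<in> lists \<Sigma>. x # u \<in> L}"
    then show "w \<in> {u \<in> lists \<Sigma>. x # u \<in> L}"
      using commutative_lang_mset[OF com, of "x # v" "x # w"] by simp
  qed auto
  then show "{u \<in> lists \<Sigma>. x # u \<in> L} \<in> commutative_regular_langs \<Sigma>"
    using regular_lang_left_quotient[OF reg \<open>x \<in> \<Sigma>\<close>] unfolding commutative_regular_langs_def by blast
  have "commutative_lang \<Sigma> {u \<in> lists \<Sigma>. u @ [x] \<in> L}"
  proof (rule commutative_langI)
    fix v w
    assume "mset v = mset w" "w \<in> lists \<Sigma>" "v \<in> {u \<in> lists \<Sigma>. u @ [x] \<in> L}"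
    then show "w \<in> {u \<in> lists \<Sigma>. u @ [x] \<in> L}"
      using commutative_lang_mset[OF com, of "v @ [x]" "w @ [x]"] by simp
  qed auto
  then show "{u \<in> lists \<Sigma>. u @ [x] \<in> L} \<in> commutative_regular_langs \<Sigma>"
    using regular_lang_right_quotient[OF reg \<open>x \<in> \<Sigma>\<close>] unfolding commutative_regular_langs_def by blast
qed

section \<open>Quotients and restrictions in a variety\<close>

context variety
begin

text \<open>Quotients by letters are iterated: dividing by \<open>x # v\<close> means dividing by
  \<open>x\<close> first and then by \<open>v\<close>, so the induction must vary
  \<open>L\<close>.\<close>

lemma left_quotient_word:
  assumes "finite \<Sigma>" "L \<in> V \<Sigma>" "v \<in> lists \<Sigma>"
  shows "{u \<in> lists \<Sigma>. v @ u \<in> L} \<in> V \<Sigma>"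
  using assms(3,2)
proof (induction v arbitrary: L)
  case Nil
  interpret algebra "lists \<Sigma>" "V \<Sigma>"
    by (rule boolean_algebra[OF assms(1)])
  show ?case
    using Nil sets_into_space by (simp add: Collect_conj_eq Int_absorb1)
next
  case (Cons x v)
  have "{u \<in> lists \<Sigma>. v @ u \<in> {u \<in> lists \<Sigma>. x # u \<in> L}} \<in> V \<Sigma>"
    using Cons left_quotient[OF assms(1)] by blast
  moreover have "{u \<in> lists \<Sigma>. v @ u \<in> {u \<in> lists \<Sigma>. x # u \<in> L}} = {u \<in> lists \<Sigma>. (x # v) @ u \<in> L}"
    using Cons by auto
  ultimately show ?case by simp
qed

lemma restriction:
  assumes "finite \<Sigma>" "\<Gamma> \<subseteq> \<Sigma>" "L \<in> V \<Sigma>"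
  shows "{w \<in> lists \<Gamma>. w \<in> L} \<in> V \<Gamma>"
proof -
  have "word_hom \<Gamma> \<Sigma> id"
    using assms(2) by (auto simp: word_hom_def)
  from inverse_hom[OF finite_subset[OF assms(2,1)] assms(1) this assms(3)] show ?thesis
    by simp
qed

text \<open>This is one direction of Myhill-Nerode: each quotient is the language accepted from some
  state, so there are at most as many quotients as states.\<close>

lemma finite_left_quotients:
  assumes "finite \<Sigma>" "L \<in> V \<Sigma>"
  shows "finite ((\<lambda>v. {u \<in> lists \<Sigma>. v @ u \<in> L}) ` lists \<Sigma>)"
  using regular[OF assms]
proof (cases rule: regular_langE)
  case (1 Q \<delta> q0 F)
  have "(\<lambda>v. {u \<in> lists \<Sigma>. v @ u \<in> L}) ` lists \<Sigma>
      \<subseteq> (\<lambda>q. {u \<in> lists \<Sigma>. foldl \<delta> q u \<in> F}) ` Q"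
    using foldl_closed[OF 1(4) _ 1(2)] unfolding 1(5) by force
  then show ?thesis
    using 1(1) by (meson finite_imageI finite_subset)
qed

end

section \<open>Closure under projection\<close>

lemma (in commutative_variety) proj_image:
  assumes "finite \<Sigma>" "\<Gamma> \<subseteq> \<Sigma>" "L \<in> V \<Sigma>"
  shows "proj \<Gamma> ` L \<in> V \<Gamma>"
proof -
  define quot where "quot v = {u \<in> lists \<Sigma>. v @ u \<in> L}" for v
  define K where "K = \<Union> (quot ` lists (\<Sigma> - \<Gamma>))"
  have com: "commutative_lang \<Sigma> L"
    by (rule commutative[OF assms(1,3)])
  interpret algebra "lists \<Sigma>" "V \<Sigma>"
    by (rule boolean_algebra[OF assms(1)])
  have sub: "lists (\<Sigma> - \<Gamma>) \<subseteq> lists \<Sigma>"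
    by auto
  \<comment> \<open>The index set is infinite when \<open>\<Sigma> - \<Gamma>\<close> is nonempty,
    but the family of quotients is finite, so closure under finite unions is enough.\<close>
  have "finite (quot ` lists (\<Sigma> - \<Gamma>))"
    using finite_left_quotients[OF assms(1,3)] sub unfolding quot_def
    by (meson finite_subset image_mono)
  moreover have "quot ` lists (\<Sigma> - \<Gamma>) \<subseteq> V \<Sigma>"
    using left_quotient_word[OF assms(1,3)] sub unfolding quot_def by blast
  ultimately have "K \<in> V \<Sigma>"
    unfolding K_def by blast
  from restriction[OF assms(1,2) this] have "{w \<in> lists \<Gamma>. w \<in> K} \<in> V \<Gamma>" .
  moreover have "proj \<Gamma> ` L = {w \<in> lists \<Gamma>. w \<in> K}"
  proof (intro equalityI subsetI)
    fix u assume "u \<in> proj \<Gamma> ` L"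
    then obtain w where w: "w \<in> L" "u = proj \<Gamma> w" by blast
    \<comment> \<open>The word \<open>v\<close> collects the letters that the projection erases;
      \<open>v @ u\<close> rearranges \<open>w\<close> and hence stays in \<open>L\<close>.\<close>
    define v where "v = filter (\<lambda>x. x \<notin> \<Gamma>) w"
    have "w \<in> lists \<Sigma>"
      using w(1) commutative_lang_subset[OF com] by blast
    then have "v \<in> lists (\<Sigma> - \<Gamma>)" "u \<in> lists \<Gamma>" "u \<in> lists \<Sigma>"
      by (auto simp: v_def w(2) proj_def)
    moreover have "v @ u \<in> L"
      using commutative_lang_mset[OF com, of w "v @ u"] w by (simp add: v_def proj_def)
    ultimately show "u \<in> {w \<in> lists \<Gamma>. w \<in> K}"
      by (auto simp: K_def quot_def)
  next
    fix u assume "u \<in> {w \<in> lists \<Gamma>. w \<in> K}"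
    then obtain v where v: "u \<in> lists \<Gamma>" "v \<in> lists (\<Sigma> - \<Gamma>)" "v @ u \<in> L"
      by (auto simp: K_def quot_def)
    \<comment> \<open>The preimage of \<open>u\<close> will be \<open>v @ u\<close>, because the
      projection erases \<open>v\<close> and fixes \<open>u\<close>.\<close>
    have "filter (\<lambda>x. x \<in> \<Gamma>) v = []" "filter (\<lambda>x. x \<in> \<Gamma>) u = u"
      using v(1,2) by (auto simp: filter_empty_conv filter_id_conv)
    then show "u \<in> proj \<Gamma> ` L"
      using v(3) by (intro image_eqI[of _ _ "v @ u"]) (simp_all add: proj_def)
  qed
  ultimately show ?thesis by simp
qed

theorem theorem15:
  "(\<forall>(V :: 'a lang_class) \<Sigma> \<Gamma> L.
      commutative_variety V \<longrightarrow> finite \<Sigma> \<longrightarrow> \<Gamma> \<subseteq> \<Sigma> \<longrightarrow> L \<in> V \<Sigma> \<longrightarrow> proj \<Gamma> ` L \<in> V \<Gamma>) \<and>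
   commutative_variety (commutative_regular_langs :: 'a lang_class) \<and>
   (\<forall>(\<Sigma> :: 'a set) \<Gamma> L.
      finite \<Sigma> \<longrightarrow> \<Gamma> \<subseteq> \<Sigma> \<longrightarrow> L \<in> commutative_regular_langs \<Sigma> \<longrightarrow>
      proj \<Gamma> ` L \<in> commutative_regular_langs \<Gamma>)"
  using commutative_variety.proj_image commutative_variety_regular by blast

end
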